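(* For arbitrary $su(n)$, let $(D_a)_{bc}=d_{abc}$, $a,b,c=1,\dots,n^2-1$. Then $$\mathrm{Tr}\,D_{(a}D_bD_cD_dD_eD_{f)}=\frac{4(n^2-4)}{n^3}\,\delta_{(ab}\delta_{cd}\delta_{ef)}+\frac{n^2-192}{16n}\,d_{(ab}{}^{x}d_{cd}{}^{y}d_{ef)}{}^{z}\,d_{xyz}+\frac34\,\frac{3n^2-64}{n^2}\,\delta_{(ab}d_{cd}{}^{x}d_{ef)x}+\frac{5n^2+48}{4n^2}\,d_{(abc}d_{def)} .$$
   Context: The totally symmetric traceless $su(n)$ tensor $d_{abc}$ is defined from the hermitian traceless $n\times n$ matrices $T_a$, $a=1,\dots,n^2-1$, normalised by $\mathrm{Tr}(T_aT_b)=\frac12\delta_{ab}$, through $\{T_a,T_b\}=\frac1n\delta_{ab}+d_{abc}T_c$. Indices are raised and lowered with $\delta_{ab}$ and repeated indices are summed; round brackets denote unit-weight symmetrisation over the free indices $a,b,c,d,e,f$. *)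

theory Defs
  imports "HOL-Analysis.Analysis" "HOL-Combinatorics.Permutations"
begin

definition delta :: "'a \<Rightarrow> 'a \<Rightarrow> real" where
  "delta a b = (if a = b then 1 else 0)"

definition hermitian :: "complex ^ 'n ^ 'n \<Rightarrow> bool" where
  "hermitian A \<longleftrightarrow> (\<chi> i j. cnj (A $ j $ i)) = A"

text \<open>
  The adjoint indices $a = 1, \dots, n^2 - 1$ are the elements of a finite type
  \<open>'a\<close>. As types are nonempty, \<open>'a\<close> can only have $n^2 - 1$ elements for $n \ge 2$;
  for $n = 1$ there are no generators.
\<close>

definition su_generators :: "('a::finite \<Rightarrow> complex ^ 'n::finite ^ 'n) \<Rightarrow> bool" where
  "su_generators T \<longleftrightarrow>
     CARD('a) = CARD('n)\<^sup>2 - 1 \<and>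
     (\<forall>a. hermitian (T a) \<and> trace (T a) = 0) \<and>
     (\<forall>a b. trace (T a ** T b) = of_real (delta a b / 2))"

text \<open>
  The anticommutator relation determines \<open>d\<close> uniquely, because the generators are
  linearly independent. Total symmetry and tracelessness of \<open>d\<close> are consequences of it,
  and so are not required here.
\<close>

definition is_d_tensor ::
  "('a::finite \<Rightarrow> complex ^ 'n::finite ^ 'n) \<Rightarrow> ('a \<Rightarrow> 'a \<Rightarrow> 'a \<Rightarrow> real) \<Rightarrow> bool" where
  "is_d_tensor T d \<longleftrightarrow>
     (\<forall>a b. T a ** T b + T b ** T a =
        mat (of_real (delta a b / real CARD('n))) + (\<Sum>c\<in>UNIV. d a b c *\<^sub>R T c))"

definition D_matrix :: "('a::finite \<Rightarrow> 'a \<Rightarrow> 'a \<Rightarrow> real) \<Rightarrow> 'a \<Rightarrow> real ^ 'a ^ 'a" where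
  "D_matrix d a = (\<chi> b c. d a b c)"

text \<open>
  Unit-weight symmetrisation of a tensor with six indices: the average over all
  permutations of the six index slots.
\<close>

definition sym6 ::
  "('a \<Rightarrow> 'a \<Rightarrow> 'a \<Rightarrow> 'a \<Rightarrow> 'a \<Rightarrow> 'a \<Rightarrow> real) \<Rightarrow> 'a \<Rightarrow> 'a \<Rightarrow> 'a \<Rightarrow> 'a \<Rightarrow> 'a \<Rightarrow> 'a \<Rightarrow> real" where
  "sym6 F a b c d e f =
     (\<Sum>p | p permutes {..<6::nat}.
        let i = (\<lambda>k. [a, b, c, d, e, f] ! p k) in F (i 0) (i 1) (i 2) (i 3) (i 4) (i 5)) / fact 6"

end

(*
  Contracting all six indices with a vector u and polarising, the identity becomes one between
  homogeneous polynomials in u. With X = u_a T_a and p_k = tr X^k, contracting D with u gives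
  P A P, where A is the anticommutator with X and P the projection of gl(n) onto the traceless
  matrices. Completeness of the T_a turns tr (P A P)^6 into a polynomial in the p_k; on the other
  side, the vector d_abc u_a u_b corresponds to the matrix 2 X^2 - 2 p_2 / n, so that all
  contractions on the right are polynomials in the p_k as well, and the two polynomials agree.
*)

theory Submission
  imports Defs
begin

section \<open>Polarisation\<close>

text \<open>The obstacle is the projection. Without it, the sixth power of the anticommutator map V
  -> X V + V X expands binomially into words X^i V X^j, and its trace is the sum of binomial(6,i)
  p_i p_(6-i). With P after every factor, each step also emits a multiple of the identity, which the
  remaining steps turn into a polynomial in X. Two families of traces are therefore followed
  together: one for words that still enclose the generator, one for the powers of X that a
  projection leaves behind. At the end both are evaluated by contractions of completeness, one
  splitting a trace into two, the other joining two traces into one. On the other side of the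
  identity, the matrix of d_abc u_a u_b is again of the form v_a T_a, so the formulas for tr X^2 and
  tr X^3 as contractions hold for it too and yield the terms of degree 4 and 6 in X.\<close>

definition contract :: "('a::finite \<Rightarrow> real) \<Rightarrow> ('a \<Rightarrow> real) \<Rightarrow> real" where
  "contract u h = (\<Sum>a\<in>UNIV. u a * h a)"

text \<open>Nested one-index contractions rather than a single sum over tuples: factors independent
  of the innermost index can then be pulled out one level at a time.\<close>

definition contract6 ::
  "('a::finite \<Rightarrow> 'a \<Rightarrow> 'a \<Rightarrow> 'a \<Rightarrow> 'a \<Rightarrow> 'a \<Rightarrow> real) \<Rightarrow> ('a \<Rightarrow> real) \<Rightarrow> real" where
  "contract6 F u =
     contract u (\<lambda>a. contract u (\<lambda>b. contract u (\<lambda>c.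
       contract u (\<lambda>e. contract u (\<lambda>f. contract u (\<lambda>g. F a b c e f g))))))"

lemma contract_mult_left: "contract u (\<lambda>a. k * h a) = k * contract u h"
  by (simp add: contract_def sum_distrib_left mult.left_commute)

lemma contract_mult_right: "contract u (\<lambda>a. h a * k) = contract u h * k"
  by (simp add: contract_def sum_distrib_right mult.assoc)

lemma contract_sum: "contract u (\<lambda>a. \<Sum>x\<in>S. h a x) = (\<Sum>x\<in>S. contract u (\<lambda>a. h a x))"
  unfolding contract_def sum_distrib_left by (rule sum.swap)

lemma contract_swap:
  "contract u (\<lambda>a. contract v (\<lambda>b. h a b)) = contract v (\<lambda>b. contract u (\<lambda>a. h a b))"
  unfolding contract_def[of v] by (simp add: contract_sum contract_mult_left)

lemma contract_delta: "contract u (delta a) = u a"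
proof -
  have "contract u (delta a) = (\<Sum>b\<in>UNIV. if a = b then u b else 0)"
    unfolding contract_def by (intro sum.cong refl) (simp add: delta_def)
  then show ?thesis by simp
qed

text \<open>The vectors used for polarisation are sums of basis vectors. The map \<open>i\<close>
  need not be injective, so an index value that fills several slots counts with
  multiplicity.\<close>

lemma contract_sum_delta: "contract (\<lambda>a. \<Sum>k\<in>S. delta a (i k)) h = (\<Sum>k\<in>S. h (i k))"
proof -
  have "(\<Sum>a\<in>UNIV. (\<Sum>k\<in>S. delta a (i k)) * h a) = (\<Sum>k\<in>S. \<Sum>a\<in>UNIV. delta a (i k) * h a)"
    by (subst sum.swap) (simp add: sum_distrib_right)
  also have "\<dots> = (\<Sum>k\<in>S. h (i k))"
  proof (intro sum.cong refl)
    fix k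
    have "delta a (i k) * h a = (if a = i k then h a else 0)" for a
      by (simp add: delta_def)
    then show "(\<Sum>a\<in>UNIV. delta a (i k) * h a) = h (i k)" by simp
  qed
  finally show ?thesis by (simp add: contract_def)
qed

text \<open>The alternating sum is the expansion of a product over \<open>U\<close> whose factor at
  x is -1 for x in \<open>K\<close> and -1 + 1 = 0 otherwise; a single element of \<open>U\<close>
  outside \<open>K\<close> annihilates it.\<close>

lemma sum_sign_supersets:
  fixes U :: "'a set"
  assumes "finite U" "K \<subseteq> U"
  shows "(\<Sum>S\<in>Pow U. (-1) ^ card S * (if K \<subseteq> S then 1 else 0)) =
    (if K = U then (-1) ^ card U else (0::real))"
proof -
  have "(\<Sum>S\<in>Pow U. (-1) ^ card S * (if K \<subseteq> S then 1 else (0::real))) =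
      (\<Sum>S\<in>Pow U. (\<Prod>x\<in>S. -1) * (\<Prod>x\<in>U-S. if x \<in> K then 0 else 1))"
  proof (intro sum.cong refl arg_cong2[where f = "(*)"])
    fix S assume S: "S \<in> Pow U"
    show "(if K \<subseteq> S then 1 else (0::real)) = (\<Prod>x\<in>U-S. if x \<in> K then 0 else 1)"
    proof (cases "K \<subseteq> S")
      case True
      then have "(\<Prod>x\<in>U-S. if x \<in> K then 0 else (1::real)) = 1"
        by (intro prod.neutral) auto
      then show ?thesis using True by simp
    next
      case False
      then have "\<exists>x\<in>U - S. (if x \<in> K then 0 else (1::real)) = 0" using assms(2) by auto
      then have "(\<Prod>x\<in>U-S. if x \<in> K then 0 else (1::real)) = 0"
        using assms(1) by (intro prod_zero) simp_all
      then show ?thesis using False by simp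
    qed
  qed simp
  also have "\<dots> = (\<Prod>x\<in>U. -1 + (if x \<in> K then 0 else 1))"
    by (rule prod_add[OF assms(1), symmetric])
  also have "\<dots> = (if K = U then (-1) ^ card U else 0)"
  proof (cases "K = U")
    case True
    then show ?thesis by simp
  next
    case False
    then have "\<exists>x\<in>U. -1 + (if x \<in> K then 0 else (1::real)) = 0" using assms(2) by auto
    then have "(\<Prod>x\<in>U. -1 + (if x \<in> K then 0 else (1::real))) = 0"
      by (intro prod_zero assms(1))
    then show ?thesis using False by simp
  qed
  finally show ?thesis .
qed

text \<open>Six values that exhaust a six-element set are distinct, so covering
  \<open>{..<6}\<close> already characterises the value tuples of permutations. Covering is the
  condition that inclusion-exclusion produces. The inverse map must be the identity beyond 5, as
  \<open>permutes\<close> demands.\<close>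

lemma sum_permutes6:
  fixes h :: "nat \<Rightarrow> nat \<Rightarrow> nat \<Rightarrow> nat \<Rightarrow> nat \<Rightarrow> nat \<Rightarrow> real"
  shows "(\<Sum>p | p permutes {..<6}. h (p 0) (p 1) (p 2) (p 3) (p 4) (p 5)) =
    (\<Sum>(k0, k1, k2, k3, k4, k5) | {k0, k1, k2, k3, k4, k5} = {..<6}. h k0 k1 k2 k3 k4 k5)"
proof (rule sum.reindex_bij_witness[where
      j = "\<lambda>p. (p 0, p 1, p 2, p 3, p 4, p 5)" and
      i = "\<lambda>(k0, k1, k2, k3, k4, k5) j. if j < 6 then [k0, k1, k2, k3, k4, k5] ! j else j"])
  have less6: "{..<6::nat} = {0, 1, 2, 3, 4, 5}" by auto
  have cases6: "j = 0 \<or> j = 1 \<or> j = 2 \<or> j = 3 \<or> j = 4 \<or> j = 5" if "j < 6" for j :: nat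
    using that by auto
  {
    fix p :: "nat \<Rightarrow> nat" assume "p \<in> {p. p permutes {..<6}}"
    then have p: "p permutes {..<6}" by simp
    have "(\<lambda>j. if j < 6 then [p 0, p 1, p 2, p 3, p 4, p 5] ! j else j) = p"
    proof
      fix j
      show "(if j < 6 then [p 0, p 1, p 2, p 3, p 4, p 5] ! j else j) = p j"
        using cases6[of j] permutes_not_in[OF p, of j] by auto
    qed
    then show "(case (p 0, p 1, p 2, p 3, p 4, p 5) of (k0, k1, k2, k3, k4, k5) \<Rightarrow>
        \<lambda>j. if j < 6 then [k0, k1, k2, k3, k4, k5] ! j else j) = p" by (simp only: prod.case)
    have "p ` {0, 1, 2, 3, 4, 5} = {..<6}"
      using permutes_image[OF p] less6 by simp
    then show "(p 0, p 1, p 2, p 3, p 4, p 5) \<in>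
        {(k0, k1, k2, k3, k4, k5). {k0, k1, k2, k3, k4, k5} = {..<6}}" by simp
  }
  fix q :: "nat \<times> nat \<times> nat \<times> nat \<times> nat \<times> nat"
  assume q: "q \<in> {(k0, k1, k2, k3, k4, k5). {k0, k1, k2, k3, k4, k5} = {..<6}}"
  obtain k0 k1 k2 k3 k4 k5 where qk: "q = (k0, k1, k2, k3, k4, k5)" by (cases q)
  define p where "p = (\<lambda>j. if j < 6 then [k0, k1, k2, k3, k4, k5] ! j else j)"
  have "p ` {..<6} = {..<6}"
  proof -
    have "{k0, k1, k2, k3, k4, k5} = {..<6}" using q by (simp only: qk mem_Collect_eq prod.case)
    moreover have "p ` {0, 1, 2, 3, 4, 5} = {k0, k1, k2, k3, k4, k5}"
      by (simp add: p_def)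
    ultimately show ?thesis by (simp only: less6)
  qed
  moreover from this have "inj_on p {..<6}"
    by (intro eq_card_imp_inj_on) simp_all
  ultimately have "bij_betw p {..<6} {..<6}"
    by (simp add: bij_betw_def)
  then have "p permutes {..<6}"
    by (rule bij_imp_permutes) (simp add: p_def)
  then show "(case q of (k0, k1, k2, k3, k4, k5) \<Rightarrow>
      \<lambda>j. if j < 6 then [k0, k1, k2, k3, k4, k5] ! j else j) \<in> {p. p permutes {..<6}}"
    by (simp add: qk p_def)
  show "(\<lambda>p. (p 0, p 1, p 2, p 3, p 4, p 5)) (case q of (k0, k1, k2, k3, k4, k5) \<Rightarrow>
      \<lambda>j. if j < 6 then [k0, k1, k2, k3, k4, k5] ! j else j) = q"
    by (simp add: qk)
qed simp

text \<open>Moving the dependence on \<open>S\<close> from the range of summation into an indicator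
  allows the sum over subsets to be exchanged with the sum over tuples.\<close>

lemma sum6_restrict:
  fixes h :: "nat \<Rightarrow> nat \<Rightarrow> nat \<Rightarrow> nat \<Rightarrow> nat \<Rightarrow> nat \<Rightarrow> real"
  assumes "finite U" "S \<subseteq> U"
  shows "(\<Sum>k0\<in>S. \<Sum>k1\<in>S. \<Sum>k2\<in>S. \<Sum>k3\<in>S. \<Sum>k4\<in>S. \<Sum>k5\<in>S. h k0 k1 k2 k3 k4 k5) =
    (\<Sum>(k0, k1, k2, k3, k4, k5)\<in>U \<times> U \<times> U \<times> U \<times> U \<times> U.
       (if {k0, k1, k2, k3, k4, k5} \<subseteq> S then 1 else 0) * h k0 k1 k2 k3 k4 k5)"
proof -
  have "(\<Sum>k0\<in>S. \<Sum>k1\<in>S. \<Sum>k2\<in>S. \<Sum>k3\<in>S. \<Sum>k4\<in>S. \<Sum>k5\<in>S. h k0 k1 k2 k3 k4 k5) =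
    (\<Sum>(k0, k1, k2, k3, k4, k5)\<in>S \<times> S \<times> S \<times> S \<times> S \<times> S. h k0 k1 k2 k3 k4 k5)"
    by (simp add: sum.cartesian_product)
  also have "\<dots> = (\<Sum>(k0, k1, k2, k3, k4, k5)\<in>U \<times> U \<times> U \<times> U \<times> U \<times> U.
       (if {k0, k1, k2, k3, k4, k5} \<subseteq> S then 1 else 0) * h k0 k1 k2 k3 k4 k5)"
    by (rule sum.mono_neutral_cong_left) (use assms in \<open>auto split: if_splits\<close>)
  finally show ?thesis .
qed

text \<open>Polarisation by inclusion-exclusion: only those index maps survive the alternating sum
  that hit each of the six slots.\<close>

lemma sym6_polarisation:
  fixes F :: "'a::finite \<Rightarrow> 'a \<Rightarrow> 'a \<Rightarrow> 'a \<Rightarrow> 'a \<Rightarrow> 'a \<Rightarrow> real"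
  shows "sym6 F i0 i1 i2 i3 i4 i5 =
    (\<Sum>S\<in>Pow {..<6}. (-1) ^ card S *
       contract6 F (\<lambda>a. \<Sum>k\<in>S. delta a ([i0, i1, i2, i3, i4, i5] ! k))) / fact 6"
proof -
  define U where "U = {..<6::nat}"
  define i where "i = (\<lambda>k. [i0, i1, i2, i3, i4, i5] ! k)"
  define h where "h k0 k1 k2 k3 k4 k5 = F (i k0) (i k1) (i k2) (i k3) (i k4) (i k5)"
    for k0 k1 k2 k3 k4 k5
  let ?U6 = "U \<times> U \<times> U \<times> U \<times> U \<times> U"
  have U: "finite U" and card_U: "card U = 6" by (simp_all add: U_def)
  have "(\<Sum>S\<in>Pow U. (-1) ^ card S * contract6 F (\<lambda>a. \<Sum>k\<in>S. delta a (i k))) =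
    (\<Sum>S\<in>Pow U. (-1) ^ card S * (\<Sum>k0\<in>S. \<Sum>k1\<in>S. \<Sum>k2\<in>S. \<Sum>k3\<in>S. \<Sum>k4\<in>S. \<Sum>k5\<in>S. h k0 k1 k2 k3 k4 k5))"
    unfolding contract6_def contract_sum_delta h_def ..
  also have "\<dots> = (\<Sum>S\<in>Pow U. \<Sum>(k0, k1, k2, k3, k4, k5)\<in>?U6. h k0 k1 k2 k3 k4 k5 *
      ((-1) ^ card S * (if {k0, k1, k2, k3, k4, k5} \<subseteq> S then 1 else 0)))"
  proof (rule sum.cong[OF refl])
    fix S assume "S \<in> Pow U"
    then have "S \<subseteq> U" by simp
    show "(-1) ^ card S * (\<Sum>k0\<in>S. \<Sum>k1\<in>S. \<Sum>k2\<in>S. \<Sum>k3\<in>S. \<Sum>k4\<in>S. \<Sum>k5\<in>S. h k0 k1 k2 k3 k4 k5) =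
      (\<Sum>(k0, k1, k2, k3, k4, k5)\<in>?U6. h k0 k1 k2 k3 k4 k5 *
        ((-1) ^ card S * (if {k0, k1, k2, k3, k4, k5} \<subseteq> S then 1 else 0)))"
      unfolding sum6_restrict[OF U \<open>S \<subseteq> U\<close>] sum_distrib_left
      by (intro sum.cong refl) (auto simp: case_prod_beta)
  qed
  also have "\<dots> = (\<Sum>(k0, k1, k2, k3, k4, k5)\<in>?U6. h k0 k1 k2 k3 k4 k5 *
      (\<Sum>S\<in>Pow U. (-1) ^ card S * (if {k0, k1, k2, k3, k4, k5} \<subseteq> S then 1 else 0)))"
    by (subst sum.swap, intro sum.cong refl) (auto simp: sum_distrib_left)
  also have "\<dots> = (\<Sum>(k0, k1, k2, k3, k4, k5)\<in>?U6. h k0 k1 k2 k3 k4 k5 *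
      (if {k0, k1, k2, k3, k4, k5} = U then (-1) ^ card U else 0))"
  proof (rule sum.cong[OF refl], clarify)
    fix k0 k1 k2 k3 k4 k5
    assume "k0 \<in> U" "k1 \<in> U" "k2 \<in> U" "k3 \<in> U" "k4 \<in> U" "k5 \<in> U"
    then have "{k0, k1, k2, k3, k4, k5} \<subseteq> U" by simp
    from sum_sign_supersets[OF U this]
    show "h k0 k1 k2 k3 k4 k5 *
      (\<Sum>S\<in>Pow U. (-1) ^ card S * (if {k0, k1, k2, k3, k4, k5} \<subseteq> S then 1 else 0)) =
      h k0 k1 k2 k3 k4 k5 * (if {k0, k1, k2, k3, k4, k5} = U then (-1) ^ card U else 0)"
      by simp
  qed
  \<comment> \<open>The surviving sign is (-1)^6 = 1.\<close>
  also have "\<dots> = (\<Sum>(k0, k1, k2, k3, k4, k5) | {k0, k1, k2, k3, k4, k5} = U. h k0 k1 k2 k3 k4 k5)"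
  proof (rule sum.mono_neutral_cong_right)
    show "finite ?U6" using U by simp
    show "{(k0, k1, k2, k3, k4, k5). {k0, k1, k2, k3, k4, k5} = U} \<subseteq> ?U6" by auto
    show "\<forall>q\<in>?U6 - {(k0, k1, k2, k3, k4, k5). {k0, k1, k2, k3, k4, k5} = U}.
      (case q of (k0, k1, k2, k3, k4, k5) \<Rightarrow> h k0 k1 k2 k3 k4 k5 *
        (if {k0, k1, k2, k3, k4, k5} = U then (-1) ^ card U else 0)) = 0"
      by (simp add: case_prod_beta)
  next
    fix q assume "q \<in> {(k0, k1, k2, k3, k4, k5). {k0, k1, k2, k3, k4, k5} = U}"
    then show "(case q of (k0, k1, k2, k3, k4, k5) \<Rightarrow> h k0 k1 k2 k3 k4 k5 *
        (if {k0, k1, k2, k3, k4, k5} = U then (-1) ^ card U else 0)) =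
      (case q of (k0, k1, k2, k3, k4, k5) \<Rightarrow> h k0 k1 k2 k3 k4 k5)"
      by (simp add: case_prod_beta card_U)
  qed
  also have "\<dots> = (\<Sum>p | p permutes {..<6}. h (p 0) (p 1) (p 2) (p 3) (p 4) (p 5))"
    unfolding sum_permutes6 U_def ..
  finally show ?thesis
    unfolding sym6_def by (simp add: U_def h_def i_def Let_def)
qed

lemma contract6_delta:
  "contract6 (\<lambda>a b c e f g. delta a b * delta c e * delta f g) u = contract u u ^ 3"
  by (simp add: contract6_def contract_mult_left contract_mult_right contract_delta power3_eq_cube)

section \<open>Matrices\<close>

text \<open>Complex scalars enter throughout as scalar matrices \<open>mat c\<close>, so that
  scaling is an instance of the matrix product and is moved around by associativity and
  \<open>mult_mat_commute\<close>.\<close>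

lemma mat_mult_nth: "(mat c ** A) $ i $ j = c * (A $ i $ j)"
  for A :: "'a::comm_semiring_1 ^ 'n::finite ^ 'n"
proof -
  have "(mat c ** A) $ i $ j = (\<Sum>k\<in>UNIV. if i = k then c * A $ k $ j else 0)"
    by (simp add: matrix_matrix_mult_def mat_def if_distrib[where f = "\<lambda>z. z * _"] cong: if_cong)
  then show ?thesis by simp
qed

lemma mult_mat_commute: "A ** mat c = mat c ** A"
  for A :: "'a::comm_semiring_1 ^ 'n::finite ^ 'n"
proof -
  have "(A ** mat c) $ i $ j = (\<Sum>k\<in>UNIV. if k = j then c * A $ i $ k else 0)" for i j
    by (simp add: matrix_matrix_mult_def mat_def mult.commute if_distrib[where f = "\<lambda>z. _ * z"]
        cong: if_cong)
  then show ?thesis by (simp add: vec_eq_iff mat_mult_nth)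
qed

lemma mult_mat_mult: "A ** (mat c ** B) = mat c ** (A ** B)"
  for A :: "'a::comm_semiring_1 ^ 'n::finite ^ 'n"
  by (simp add: matrix_mul_assoc mult_mat_commute)

lemma mat_mult_mat: "mat b ** mat c = (mat (b * c) :: 'a::comm_semiring_1 ^ 'n::finite ^ 'n)"
  unfolding vec_eq_iff mat_mult_nth by (simp add: mat_def)

lemma mat_mult_mult_mat_mult: "(mat b ** A) ** (mat c ** B) = mat (b * c) ** (A ** B)"
  for A :: "'a::comm_semiring_1 ^ 'n::finite ^ 'n"
  by (simp only: mult_mat_mult) (simp add: matrix_mul_assoc mat_mult_mat mult.commute)

lemma mat_2_mult: "mat 2 ** A = A + A"
  for A :: "'a::comm_semiring_1 ^ 'n::finite ^ 'n"
  unfolding vec_eq_iff mat_mult_nth by (simp add: mult_2)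

lemma matrix_add_rdistrib: "(A + B) ** C = A ** C + B ** C"
  for A :: "'a::semiring_1 ^ 'n::finite ^ 'm::finite"
  by (simp add: vec_eq_iff matrix_matrix_mult_def distrib_right sum.distrib)

lemma matrix_diff_ldistrib: "A ** (B - C) = A ** B - A ** C"
  for A :: "'a::comm_ring_1 ^ 'n::finite ^ 'm::finite"
  by (simp add: vec_eq_iff matrix_matrix_mult_def right_diff_distrib sum_subtractf)

lemma matrix_diff_rdistrib: "(A - B) ** C = A ** C - B ** C"
  for A :: "'a::comm_ring_1 ^ 'n::finite ^ 'm::finite"
  by (simp add: vec_eq_iff matrix_matrix_mult_def left_diff_distrib sum_subtractf)

lemma matrix_mult_sum_right: "A ** (\<Sum>x\<in>S. f x) = (\<Sum>x\<in>S. A ** f x)"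
  for A :: "'a::comm_semiring_1 ^ 'n::finite ^ 'm::finite"
  by (simp add: vec_eq_iff matrix_matrix_mult_def sum_distrib_left) (subst sum.swap, simp)

lemma matrix_mult_sum_left: "(\<Sum>x\<in>S. f x) ** A = (\<Sum>x\<in>S. f x ** A)"
  for A :: "'a::comm_semiring_1 ^ 'n::finite ^ 'm::finite"
  by (simp add: vec_eq_iff matrix_matrix_mult_def sum_distrib_right) (subst sum.swap, simp)

lemma trace_sum: "trace (\<Sum>x\<in>S. f x) = (\<Sum>x\<in>S. trace (f x))"
  for f :: "_ \<Rightarrow> 'a::comm_semiring_1 ^ 'n::finite ^ 'n"
  by (induction S rule: infinite_finite_induct) (simp_all add: trace_add trace_0[simplified])

lemma trace_mat_mult: "trace (mat c ** A) = c * trace A"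
  for A :: "'a::comm_semiring_1 ^ 'n::finite ^ 'n"
  by (simp add: trace_def mat_mult_nth sum_distrib_left)

lemma trace_mult_mat_mult: "trace (A ** (mat c ** B)) = c * trace (A ** B)"
  for A :: "'a::comm_semiring_1 ^ 'n::finite ^ 'n"
  by (simp only: mult_mat_mult trace_mat_mult)

lemma trace_mat: "trace (mat c :: 'a::comm_semiring_1 ^ 'n::finite ^ 'n) = of_nat CARD('n) * c"
  by (simp add: trace_def mat_def)

lemma trace_mult: "trace (A ** B) = (\<Sum>i\<in>UNIV. \<Sum>j\<in>UNIV. A $ i $ j * B $ j $ i)"
  by (simp add: trace_def matrix_matrix_mult_def)

lemma mat_sum_mult: "mat (\<Sum>x\<in>S. f x) ** A = (\<Sum>x\<in>S. mat (f x) ** A)"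
  for A :: "'a::comm_semiring_1 ^ 'n::finite ^ 'n"
  unfolding vec_eq_iff by (simp only: mat_mult_nth sum_component sum_distrib_right) simp

lemma scaleR_eq_mat_mult: "r *\<^sub>R A = mat (of_real r) ** A"
  for A :: "complex ^ 'n::finite ^ 'n"
  by (simp add: vec_eq_iff mat_mult_nth scaleR_conv_of_real[where 'a = complex])

primrec mpow :: "'a::comm_semiring_1 ^ 'n::finite ^ 'n \<Rightarrow> nat \<Rightarrow> 'a ^ 'n ^ 'n" where
  "mpow A 0 = mat 1"
| "mpow A (Suc k) = A ** mpow A k"

lemma mpow_add: "mpow A (i + j) = mpow A i ** mpow A j"
  by (induction i) (simp_all add: matrix_mul_assoc)

lemma mpow_mult_commute: "mpow A k ** A = A ** mpow A k"
  by (induction k) (simp_all add: matrix_mul_assoc[symmetric])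

text \<open>Linearity of the trace in one factor. The free neighbours \<open>M\<close> and
  \<open>K\<close> let the same lemma contract each of the six factors in turn.\<close>

lemma contract_trace_D_matrix:
  fixes M K :: "real ^ 'a::finite ^ 'a"
  shows "contract u (\<lambda>a. trace (M ** D_matrix d a ** K)) =
    trace (M ** (\<chi> b c. contract u (\<lambda>a. d a b c)) ** K)"
proof -
  have "(\<chi> b c. contract u (\<lambda>a. d a b c)) = (\<Sum>a\<in>UNIV. mat (u a) ** D_matrix d a)"
    unfolding vec_eq_iff by (simp only: sum_component mat_mult_nth) (simp add: contract_def D_matrix_def)
  then show ?thesis
    by (simp add: matrix_mult_sum_left matrix_mult_sum_right trace_sum contract_def mult_mat_mult
        trace_mat_mult trace_mult_mat_mult flip: matrix_mul_assoc)
qed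

text \<open>Meant for Y = X^2 and c = 2 p_2 / n, where \<open>W\<close> is the matrix of the vector
  d_abc u_a u_b; its second and third moments then become moments of X.\<close>

lemma trace_affine_powers:
  fixes Y :: "complex ^ 'n::finite ^ 'n" and c :: complex
  defines "W \<equiv> mat 2 ** Y - mat c"
  shows "trace (W ** W) = 4 * trace (Y ** Y) - 4 * c * trace Y + of_nat CARD('n) * c\<^sup>2"
    and "trace (W ** (W ** W)) = 8 * trace (Y ** (Y ** Y)) - 12 * c * trace (Y ** Y)
      + 6 * c\<^sup>2 * trace Y - of_nat CARD('n) * c ^ 3"
proof -
  have assoc: "mat x ** (mat y ** A) = mat (x * y) ** A" "(mat x ** A) ** mat y = mat (x * y) ** A"
    for x y and A :: "complex ^ 'n ^ 'n"
    by (simp_all only: mult_mat_commute[of "mat x ** A"])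
       (simp_all add: matrix_mul_assoc mat_mult_mat mult.commute)
  show "trace (W ** W) = 4 * trace (Y ** Y) - 4 * c * trace Y + of_nat CARD('n) * c\<^sup>2"
    unfolding W_def
    by (simp only: matrix_diff_ldistrib matrix_diff_rdistrib mat_mult_mult_mat_mult assoc mat_mult_mat
        trace_sub trace_mat_mult trace_mat) (simp add: algebra_simps power2_eq_square)
  show "trace (W ** (W ** W)) = 8 * trace (Y ** (Y ** Y)) - 12 * c * trace (Y ** Y)
      + 6 * c\<^sup>2 * trace Y - of_nat CARD('n) * c ^ 3"
    unfolding W_def
    by (simp only: matrix_diff_ldistrib matrix_diff_rdistrib mat_mult_mult_mat_mult assoc mat_mult_mat
        trace_sub trace_mat_mult trace_mat) (simp add: algebra_simps power2_eq_square power3_eq_cube)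
qed

section \<open>Completeness of the generators\<close>

lemma su_generators_trace:
  assumes "su_generators T"
  shows "trace (T a) = 0"
  using assms unfolding su_generators_def by blast

lemma su_generators_trace_mult:
  assumes "su_generators T"
  shows "trace (T a ** T b) = of_real (delta a b / 2)"
  using assms unfolding su_generators_def by blast

lemma sum_UNIV_option: "(\<Sum>x\<in>UNIV. f x) = f None + (\<Sum>a\<in>UNIV. f (Some a))"
  for f :: "'a::finite option \<Rightarrow> 'b::comm_monoid_add"
  by (simp add: UNIV_option_conv sum.reindex)

text \<open>Orthonormality of the \<open>n\<^sup>2\<close> matrices \<open>1, T\<^sub>a\<close> says that a square matrix of size \<open>n\<^sup>2\<close> has
  a right inverse; completeness is the statement that this is also a left inverse.\<close>

lemma su_generators_completeness:
  fixes T :: "'a::finite \<Rightarrow> complex ^ 'n::finite ^ 'n"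
  assumes "su_generators T"
  shows "(\<Sum>a\<in>UNIV. T a $ i $ j * T a $ k $ l) =
    (if i = l then if j = k then 1 / 2 else 0 else 0) -
    (if i = j then if k = l then 1 / (2 * of_nat CARD('n)) else 0 else 0)"
proof -
  define N where "N = (of_nat CARD('n) :: complex)"
  have N: "N \<noteq> 0" by (simp add: N_def)
  \<comment> \<open>\<open>None\<close> is the index of the identity matrix, which completes the
    generators to n^2 matrices.\<close>
  have "CARD('a option) = CARD('n)\<^sup>2"
    using assms by (simp add: su_generators_def card_option)
  then have "card (UNIV :: 'a option set) = card (UNIV :: ('n \<times> 'n) set)"
    by (simp add: power2_eq_square)
  then obtain \<phi> :: "'a option \<Rightarrow> 'n \<times> 'n" where \<phi>: "bij \<phi>"
    using finite_same_card_bij[OF finite finite] by blast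
  define S where "S x = (case x of None \<Rightarrow> mat 1 | Some a \<Rightarrow> T a)" for x
  \<comment> \<open>The weights are the reciprocals of tr (1 1) = n and tr (T_a T_a) = 1/2, so that
    \<open>P\<close> and \<open>Q\<close> hold dual bases for the trace form.\<close>
  define c where "c x = (case x of None \<Rightarrow> 1 / N | Some a \<Rightarrow> 2)" for x :: "'a option"
  define P :: "complex ^ 'a option ^ 'a option" where
    "P = (\<chi> x y. c x * S x $ fst (\<phi> y) $ snd (\<phi> y))"
  define Q :: "complex ^ 'a option ^ 'a option" where
    "Q = (\<chi> y x. S x $ snd (\<phi> y) $ fst (\<phi> y))"
  have "(P ** Q) $ x $ y = (if x = y then 1 else 0)" for x y
  proof -
    have "(P ** Q) $ x $ y = (\<Sum>z\<in>UNIV. (\<lambda>(i, j). c x * (S x $ i $ j * S y $ j $ i)) (\<phi> z))"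
      by (simp add: P_def Q_def matrix_matrix_mult_def case_prod_beta mult.assoc)
    also have "\<dots> = (\<Sum>(i, j)\<in>UNIV. c x * (S x $ i $ j * S y $ j $ i))"
      by (rule sum.reindex_bij_betw[OF \<phi>])
    also have "\<dots> = c x * trace (S x ** S y)"
      by (simp add: trace_mult sum_distrib_left sum.cartesian_product case_prod_beta)
    also have "\<dots> = (if x = y then 1 else 0)"
    proof -
      have "trace (T a ** T b) = (if a = b then 1 / 2 else 0)" for a b
        unfolding su_generators_trace_mult[OF assms] by (simp add: delta_def)
      then show ?thesis
        using N su_generators_trace[OF assms] by (cases x; cases y) (simp_all add: S_def c_def trace_mat N_def)
    qed
    finally show ?thesis .
  qed
  then have "P ** Q = mat 1" by (simp add: vec_eq_iff mat_def)
  then have "Q ** P = mat 1" by (simp add: matrix_left_right_inverse)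
  then have "(\<Sum>x\<in>UNIV. S x $ snd (\<phi> y) $ fst (\<phi> y) * (c x * S x $ fst (\<phi> z) $ snd (\<phi> z))) =
      (if y = z then 1 else 0)" for y z
    by (simp add: vec_eq_iff matrix_matrix_mult_def mat_def P_def Q_def)
  \<comment> \<open>\<open>Q\<close> reads its index pair transposed, hence (j, i) for the entry at
    row i and column j.\<close>
  from this[of "inv \<phi> (j, i)" "inv \<phi> (k, l)"]
  have "(\<Sum>x\<in>UNIV. S x $ i $ j * (c x * S x $ k $ l)) = (if (j, i) = (k, l) then 1 else 0)"
    using \<phi> by (simp add: surj_f_inv_f bij_is_surj inj_eq bij_is_inj bij_imp_bij_inv)
  then have "mat 1 $ i $ j * (1 / N * mat 1 $ k $ l) + 2 * (\<Sum>a\<in>UNIV. T a $ i $ j * T a $ k $ l) =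
      (if j = k \<and> i = l then 1 else 0)"
    by (simp add: sum_UNIV_option S_def c_def sum_distrib_left mult.left_commute)
  moreover have aux: "s = (y - x) / 2" if "x + 2 * s = y" for x y s :: complex
    using that by auto
  ultimately have "(\<Sum>a\<in>UNIV. T a $ i $ j * T a $ k $ l) =
      ((if j = k \<and> i = l then 1 else 0) - mat 1 $ i $ j * (1 / N * mat 1 $ k $ l)) / 2"
    by blast
  also have "\<dots> = (if i = l then if j = k then 1 / 2 else 0 else 0) -
      (if i = j then if k = l then 1 / (2 * N) else 0 else 0)"
  proof -
    have "mat 1 $ i $ j * (1 / N * mat 1 $ k $ l) = (if i = j then if k = l then 1 / N else 0 else 0)"
      by (simp add: mat_def)
    then show ?thesis by (simp add: diff_divide_distrib)
  qed
  finally show ?thesis unfolding N_def .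
qed

text \<open>With \<open>M\<close> between the two generators, the first completeness term closes
  \<open>M\<close> into a trace and the second leaves it as it is.\<close>

lemma su_generators_sandwich:
  fixes T :: "'a::finite \<Rightarrow> complex ^ 'n::finite ^ 'n"
  assumes "su_generators T"
  shows "(\<Sum>a\<in>UNIV. T a ** M ** T a) =
    mat (trace M / 2) - mat (1 / (2 * of_nat CARD('n))) ** M"
proof -
  define r where "r = 1 / (2 * of_nat CARD('n) :: complex)"
  have "(\<Sum>a\<in>UNIV. T a ** M ** T a) $ i $ l = (mat (trace M / 2) - mat r ** M) $ i $ l" for i l
  proof -
    have "(\<Sum>a\<in>UNIV. T a ** M ** T a) $ i $ l =
        (\<Sum>a\<in>UNIV. \<Sum>k\<in>UNIV. \<Sum>j\<in>UNIV. M $ j $ k * (T a $ i $ j * T a $ k $ l))"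
      by (simp add: matrix_matrix_mult_def sum_distrib_right, intro sum.cong refl) simp
    also have "\<dots> = (\<Sum>k\<in>UNIV. \<Sum>j\<in>UNIV. M $ j $ k * (\<Sum>a\<in>UNIV. T a $ i $ j * T a $ k $ l))"
      unfolding sum_distrib_left
      by (subst sum.swap, rule sum.cong[OF refl], rule sum.swap)
    also have "\<dots> = (\<Sum>k\<in>UNIV. \<Sum>j\<in>UNIV. (if j = k then if i = l then M $ j $ k / 2 else 0 else 0)
        - (if i = j then if k = l then r * M $ j $ k else 0 else 0))"
      unfolding su_generators_completeness[OF assms]
      by (intro sum.cong refl) (auto simp: r_def right_diff_distrib)
    also have "\<dots> = (if i = l then trace M / 2 else 0) - r * M $ i $ l"
      by (simp add: sum_subtractf trace_def sum_divide_distrib)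
    finally show ?thesis
      unfolding vector_minus_component mat_mult_nth by (simp add: mat_def)
  qed
  then show ?thesis unfolding r_def by (simp add: vec_eq_iff)
qed

text \<open>The orthogonal projection onto traceless matrices, halved because the generators have
  squared norm 1/2.\<close>

lemma su_generators_expansion:
  fixes T :: "'a::finite \<Rightarrow> complex ^ 'n::finite ^ 'n"
  assumes "su_generators T"
  shows "(\<Sum>a\<in>UNIV. mat (trace (M ** T a)) ** T a) =
    mat (1 / 2) ** M - mat (trace M / (2 * of_nat CARD('n)))"
proof -
  define r where "r = 1 / (2 * of_nat CARD('n) :: complex)"
  have "(\<Sum>a\<in>UNIV. mat (trace (M ** T a)) ** T a) $ k $ l = (mat (1 / 2) ** M - mat (r * trace M)) $ k $ l"
    for k l
  proof -
    have "(\<Sum>a\<in>UNIV. mat (trace (M ** T a)) ** T a) $ k $ l =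
        (\<Sum>a\<in>UNIV. \<Sum>i\<in>UNIV. \<Sum>j\<in>UNIV. M $ i $ j * (T a $ j $ i * T a $ k $ l))"
      by (simp add: mat_mult_nth trace_mult sum_distrib_right mult.assoc)
    also have "\<dots> = (\<Sum>i\<in>UNIV. \<Sum>j\<in>UNIV. M $ i $ j * (\<Sum>a\<in>UNIV. T a $ j $ i * T a $ k $ l))"
      unfolding sum_distrib_left
      by (subst sum.swap, rule sum.cong[OF refl], rule sum.swap)
    also have "\<dots> = (\<Sum>i\<in>UNIV. \<Sum>j\<in>UNIV. (if j = l then if i = k then M $ i $ j / 2 else 0 else 0)
        - (if i = j then if k = l then r * M $ i $ j else 0 else 0))"
      unfolding su_generators_completeness[OF assms]
      by (intro sum.cong refl) (auto simp: r_def right_diff_distrib)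
    also have "\<dots> = M $ k $ l / 2 - (if k = l then r * trace M else 0)"
      by (simp add: sum_subtractf trace_def sum_distrib_left)
    finally show ?thesis
      unfolding vector_minus_component mat_mult_nth by (simp add: mat_def)
  qed
  then show ?thesis unfolding r_def by (simp add: vec_eq_iff)
qed

text \<open>The rule that splits a trace. It supplies the initial values of the family
  \<open>F\<close> below.\<close>

lemma su_generators_trace_sandwich:
  fixes T :: "'a::finite \<Rightarrow> complex ^ 'n::finite ^ 'n"
  assumes "su_generators T"
  shows "(\<Sum>a\<in>UNIV. trace (T a ** (A ** T a ** B))) =
    trace A * trace B / 2 - trace (A ** B) / (2 * of_nat CARD('n))"
proof -
  have "(\<Sum>a\<in>UNIV. trace (T a ** (A ** T a ** B))) = trace ((\<Sum>a\<in>UNIV. T a ** A ** T a) ** B)"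
    by (simp add: matrix_mult_sum_left trace_sum matrix_mul_assoc)
  also have "\<dots> = trace (mat (trace A / 2) ** B) - trace (mat (1 / (2 * of_nat CARD('n))) ** (A ** B))"
    by (simp add: su_generators_sandwich[OF assms] matrix_diff_rdistrib trace_sub matrix_mul_assoc)
  finally show ?thesis by (simp add: trace_mat_mult)
qed

text \<open>The rule that joins two traces. It supplies the initial values of the family
  \<open>G\<close> below.\<close>

lemma su_generators_trace_mult_trace:
  fixes T :: "'a::finite \<Rightarrow> complex ^ 'n::finite ^ 'n"
  assumes "su_generators T"
  shows "(\<Sum>a\<in>UNIV. trace (A ** T a) * trace (T a ** B)) =
    trace (A ** B) / 2 - trace A * trace B / (2 * of_nat CARD('n))"
proof -
  have "(\<Sum>a\<in>UNIV. trace (A ** T a) * trace (T a ** B)) =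
      trace ((\<Sum>a\<in>UNIV. mat (trace (A ** T a)) ** T a) ** B)"
    by (simp add: matrix_mult_sum_left trace_sum trace_mat_mult flip: matrix_mul_assoc)
  also have "\<dots> = trace (mat (1 / 2) ** (A ** B)) - trace (mat (trace A / (2 * of_nat CARD('n))) ** B)"
    by (simp add: su_generators_expansion[OF assms] matrix_diff_rdistrib trace_sub matrix_mul_assoc)
  finally show ?thesis by (simp add: trace_mat_mult)
qed

section \<open>Multiplication by \<open>d\<close> as a projected anticommutator\<close>

text \<open>The subtracted multiple of the identity makes the result traceless, since tr (X V + V X)
  = 2 tr (X V) and tr 1 = n. The map is taken on all matrices, not only traceless ones, so that by
  linearity it can act on each word X^i T_a X^j separately.\<close>

definition dmult :: "complex ^ 'n::finite ^ 'n \<Rightarrow> complex ^ 'n ^ 'n \<Rightarrow> complex ^ 'n ^ 'n" where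
  "dmult X V = X ** V + V ** X - mat (2 / of_nat CARD('n) * trace (X ** V))"

lemma dmult_add: "dmult X (A + B) = dmult X A + dmult X B"
  by (simp add: dmult_def matrix_add_ldistrib matrix_add_rdistrib trace_add vec_eq_iff mat_def
      distrib_left)

lemma dmult_mat_mult: "dmult X (mat c ** A) = mat c ** dmult X A"
proof -
  have "X ** (mat c ** A) = mat c ** (X ** A)" "mat c ** A ** X = mat c ** (A ** X)"
    by (rule mult_mat_mult, simp add: matrix_mul_assoc)
  then show ?thesis
    by (simp add: dmult_def matrix_add_ldistrib matrix_diff_ldistrib trace_mat_mult mat_mult_mat
        mult.left_commute)
qed

lemma dmult_funpow_add: "(dmult X ^^ m) (A + B) = (dmult X ^^ m) A + (dmult X ^^ m) B"
  by (induction m) (simp_all add: dmult_add)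

lemma dmult_funpow_mat_mult: "(dmult X ^^ m) (mat c ** A) = mat c ** (dmult X ^^ m) A"
  by (induction m) (simp_all add: dmult_mat_mult)

lemma dmult_funpow_sum: "(dmult X ^^ m) (\<Sum>x\<in>S. f x) = (\<Sum>x\<in>S. (dmult X ^^ m) (f x))"
proof (induction S rule: infinite_finite_induct)
  case empty
  show ?case using dmult_funpow_mat_mult[of m X 0 0] by simp
next
  case (infinite S)
  then show ?case using dmult_funpow_mat_mult[of m X 0 0] by simp
qed (simp_all add: dmult_funpow_add)

text \<open>The scalar emitted by a projection is a multiple of X^0. Its further evolution is thus
  that of a power of X, which is why the recursion closes.\<close>

lemma dmult_funpow_diff_mat:
  "(dmult X ^^ m) (A - mat c) = (dmult X ^^ m) A - mat c ** (dmult X ^^ m) (mpow X 0)"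
proof -
  have "A - mat c = A + mat (- c) ** mpow X 0"
    by (simp add: vec_eq_iff) (simp add: mat_def)
  then have "(dmult X ^^ m) (A - mat c) =
      (dmult X ^^ m) A + mat (- c) ** (dmult X ^^ m) (mpow X 0)"
    by (simp only: dmult_funpow_add dmult_funpow_mat_mult)
  then show ?thesis
    by (simp add: vec_eq_iff mat_mult_nth)
qed

text \<open>The words X^i V X^j are stable under the anticommutator with X, and by cyclicity the
  emitted trace depends on i + j only.\<close>

lemma dmult_mpow_sandwich:
  "dmult X (mpow X i ** V ** mpow X j) =
     mpow X (Suc i) ** V ** mpow X j + mpow X i ** V ** mpow X (Suc j)
     - mat (2 / of_nat CARD('n) * trace (mpow X (Suc (i + j)) ** V))"
  for X :: "complex ^ 'n::finite ^ 'n"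
proof -
  have "trace (X ** (mpow X i ** V ** mpow X j)) = trace (mpow X j ** (X ** mpow X i ** V))"
    by (subst trace_mul_sym) (simp add: matrix_mul_assoc)
  also have "\<dots> = trace (mpow X (Suc (i + j)) ** V)"
    using mpow_add[of X j "Suc i"] by (simp add: matrix_mul_assoc add.commute)
  finally have tr: "trace (X ** (mpow X i ** V ** mpow X j)) = trace (mpow X (Suc (i + j)) ** V)" .
  have left: "X ** (mpow X i ** V ** mpow X j) = mpow X (Suc i) ** V ** mpow X j"
    by (simp add: matrix_mul_assoc)
  have right: "mpow X i ** V ** mpow X j ** X = mpow X i ** V ** mpow X (Suc j)"
    by (simp add: mpow_mult_commute flip: matrix_mul_assoc)
  show ?thesis unfolding dmult_def tr unfolding left right ..
qed

lemma dmult_mpow: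
  "dmult X (mpow X l) =
     mat 2 ** mpow X (Suc l) - mat (2 / of_nat CARD('n) * trace (mpow X (Suc l)))"
  for X :: "complex ^ 'n::finite ^ 'n"
  by (simp add: dmult_def mpow_mult_commute mat_2_mult)

section \<open>Recursion for the projected traces\<close>

text \<open>The role of \<open>F m i j\<close> is that of \<open>\<Sum>\<^sub>a tr (T\<^sub>a (dmult X)\<^sup>m (X\<^sup>i T\<^sub>a X\<^sup>j))\<close>, and that of
  \<open>G m k l\<close> is \<open>\<Sum>\<^sub>a tr (X\<^sup>k T\<^sub>a) tr (T\<^sub>a (dmult X)\<^sup>m X\<^sup>l)\<close>, which absorbs the projection terms.\<close>

lemma projected_trace_recursion:
  fixes F G :: "nat \<Rightarrow> nat \<Rightarrow> nat \<Rightarrow> complex" and p :: "nat \<Rightarrow> complex"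
  assumes F_0: "\<And>i j. F 0 i j = p i * p j / 2 - p (i + j) / (2 * N)"
    and F_Suc: "\<And>m i j. F (Suc m) i j = F m (Suc i) j + F m i (Suc j) - 2 / N * G m (Suc (i + j)) 0"
    and G_0: "\<And>k l. G 0 k l = p (k + l) / 2 - p k * p l / (2 * N)"
    and G_Suc: "\<And>m k l. G (Suc m) k l = 2 * G m k (Suc l) - 2 / N * p (Suc l) * G m k 0"
    and p: "p 0 = N" "p 1 = 0" and N: "N \<noteq> 0"
  shows "2 * F 6 0 0 = (2 * N - 384 / N) * p 6 + (30 + 384 / N\<^sup>2) * (p 2 * p 4)
    + (20 + 192 / N\<^sup>2) * (p 3)\<^sup>2 - 128 / N ^ 3 * (p 2) ^ 3"
proof -
  define H where "H m k = 2 / N * G m k 0" for m k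
  have F_Suc': "F (Suc m) i j = F m (Suc i) j + F m i (Suc j) - H m (Suc (i + j))" for m i j
    unfolding H_def F_Suc ..
  \<comment> \<open>Words that never meet a projection are counted by binomial(6,i). A first
    projection at step k can hit any of the 2^(k-1) words with i + j = k - 1, whence the weights 1,
    2, ..., 32.\<close>
  have F_6: "F 6 0 0 = 20 * F 0 3 3 + 15 * F 0 2 4 + 15 * F 0 4 2 + 6 * F 0 1 5 + 6 * F 0 5 1
     + F 0 6 0 + F 0 0 6
     - (H 5 1 + 2 * H 4 2 + 4 * H 3 3 + 8 * H 2 4 + 16 * H 1 5 + 32 * H 0 6)"
    by (simp add: F_Suc' eval_nat_numeral)
  \<comment> \<open>The identity is orthogonal to every generator, so a projection at the last step
    contributes nothing.\<close>
  have G_k0: "G 0 k 0 = 0" for k using N by (simp add: G_0 p)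
  have p1: "p (Suc 0) = 0" using p by simp
  have H: "H 0 6 = 0" "H 1 5 = 4 / N * G 0 5 1" "H 2 4 = 8 / N * G 0 4 2"
    "H 3 3 = 2 / N * (8 * G 0 3 3 - 8 / N * p 2 * G 0 3 1)"
    "H 4 2 = 2 / N * (16 * G 0 2 4 - 16 / N * p 3 * G 0 2 1 - 16 / N * p 2 * G 0 2 2)"
    "H 5 1 = 2 / N * (32 * G 0 1 5 - 32 / N * p 4 * G 0 1 1 - 32 / N * p 3 * G 0 1 2 - 32 / N * p 2 * G 0 1 3
       + 32 / N\<^sup>2 * (p 2)\<^sup>2 * G 0 1 1)"
    using N by (simp_all add: H_def G_Suc G_k0 p1 eval_nat_numeral) (simp_all add: field_simps)
  show ?thesis
    unfolding F_6 H G_0 F_0 using N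
    by (simp add: p p1 flip: numeral_2_eq_2) (simp add: field_simps power2_eq_square power3_eq_cube)
qed

section \<open>From adjoint indices to n x n matrices\<close>

locale su_tensor =
  fixes T :: "'a::finite \<Rightarrow> complex ^ 'n::finite ^ 'n"
    and d :: "'a \<Rightarrow> 'a \<Rightarrow> 'a \<Rightarrow> real"
  assumes generators: "su_generators T"
    and d_tensor: "is_d_tensor T d"
begin

text \<open>The matrix X = u_a T_a with adjoint coordinates \<open>u\<close>; not an adjoint or
  adjugate matrix.\<close>

definition adj :: "('a \<Rightarrow> real) \<Rightarrow> complex ^ 'n ^ 'n" where
  "adj u = (\<Sum>a\<in>UNIV. mat (of_real (u a)) ** T a)"

definition D_contracted :: "('a \<Rightarrow> real) \<Rightarrow> real ^ 'a ^ 'a" where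
  "D_contracted u = (\<chi> b c. contract u (\<lambda>a. d a b c))"

lemma trace_adj: "trace (adj u) = 0"
  by (simp add: adj_def trace_sum trace_mat_mult su_generators_trace[OF generators])

lemma trace_adj_mult_generator: "trace (adj u ** T b) = of_real (u b / 2)"
proof -
  have "trace (adj u ** T b) = (\<Sum>a\<in>UNIV. of_real (u a) * trace (T a ** T b))"
    by (simp add: adj_def matrix_mult_sum_left trace_sum trace_mat_mult flip: matrix_mul_assoc)
  also have "\<dots> = (\<Sum>a\<in>UNIV. if a = b then of_real (u a / 2) else 0)"
    unfolding su_generators_trace_mult[OF generators] by (intro sum.cong refl) (simp add: delta_def)
  finally show ?thesis by simp
qed

lemma trace_adj_mult_adj: "trace (adj u ** adj v) = of_real (\<Sum>a\<in>UNIV. u a * v a) / 2"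
proof -
  have "trace (adj u ** adj v) = (\<Sum>b\<in>UNIV. trace (adj u ** (mat (of_real (v b)) ** T b)))"
    unfolding adj_def[of v] by (simp add: matrix_mult_sum_right trace_sum)
  also have "\<dots> = (\<Sum>b\<in>UNIV. of_real (v b) * trace (adj u ** T b))"
    by (simp only: trace_mult_mat_mult)
  finally show ?thesis
    by (simp add: trace_adj_mult_generator sum_divide_distrib mult.commute)
qed

lemma anticommutator:
  "T a ** T b + T b ** T a =
     mat (of_real (delta a b) / of_nat CARD('n)) + (\<Sum>c\<in>UNIV. mat (of_real (d a b c)) ** T c)"
  using d_tensor unfolding is_d_tensor_def by (simp add: scaleR_eq_mat_mult)

text \<open>The delta part of the anticommutator contributes u_b / n, which is exactly the trace (2
  / n) tr (X T_b) that \<open>dmult\<close> removes; only the d part is left.\<close>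

lemma dmult_generator:
  "dmult (adj u) (T b) = (\<Sum>c\<in>UNIV. mat (of_real (D_contracted u $ b $ c)) ** T c)"
proof -
  have "adj u ** T b + T b ** adj u = (\<Sum>a\<in>UNIV. mat (of_real (u a)) ** (T a ** T b + T b ** T a))"
    by (simp add: adj_def matrix_mult_sum_left matrix_mult_sum_right matrix_add_ldistrib
        sum.distrib mult_mat_mult matrix_mul_assoc[of "mat _"])
  also have "\<dots> = (\<Sum>a\<in>UNIV. mat (of_real (u a * delta a b) / of_nat CARD('n))) +
      (\<Sum>a\<in>UNIV. \<Sum>c\<in>UNIV. mat (of_real (u a * d a b c)) ** T c)"
    by (simp add: anticommutator matrix_add_ldistrib sum.distrib mat_mult_mat matrix_mult_sum_right
        matrix_mul_assoc)
  also have "(\<Sum>a\<in>UNIV. mat (of_real (u a * delta a b) / of_nat CARD('n))) =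
      (\<Sum>a\<in>UNIV. if a = b then mat (of_real (u a) / of_nat CARD('n)) else 0 :: complex ^ 'n ^ 'n)"
    by (intro sum.cong refl) (simp add: delta_def)
  also have "(\<Sum>a\<in>UNIV. \<Sum>c\<in>UNIV. mat (of_real (u a * d a b c)) ** T c) =
      (\<Sum>c\<in>UNIV. mat (of_real (D_contracted u $ b $ c)) ** T c)"
    by (subst sum.swap)
       (simp add: D_contracted_def contract_def vec_eq_iff mat_mult_nth sum_distrib_right)
  finally show ?thesis
    by (simp add: dmult_def trace_adj_mult_generator)
qed

lemma dmult_funpow_generator:
  "(dmult (adj u) ^^ m) (T b) = (\<Sum>c\<in>UNIV. mat (of_real (mpow (D_contracted u) m $ b $ c)) ** T c)"
proof (induction m arbitrary: b)
  case 0
  have "(\<Sum>c\<in>UNIV. mat (of_real (mpow (D_contracted u) 0 $ b $ c)) ** T c) =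
      (\<Sum>c\<in>UNIV. if c = b then T c else 0)"
  proof (intro sum.cong refl)
    fix c
    have "mpow (D_contracted u) 0 $ b $ c = (if c = b then 1 else 0)" by (simp add: mat_def)
    then show "mat (of_real (mpow (D_contracted u) 0 $ b $ c)) ** T c = (if c = b then T c else 0)"
      by simp
  qed
  then show ?case by simp
next
  case (Suc m)
  let ?D = "D_contracted u"
  have "(dmult (adj u) ^^ Suc m) (T b) =
      (\<Sum>e\<in>UNIV. mat (of_real (?D $ b $ e)) ** (\<Sum>c\<in>UNIV. mat (of_real (mpow ?D m $ e $ c)) ** T c))"
    unfolding funpow_Suc_right o_apply dmult_generator dmult_funpow_sum dmult_funpow_mat_mult Suc.IH ..
  also have "\<dots> = (\<Sum>c\<in>UNIV. mat (of_real (mpow ?D (Suc m) $ b $ c)) ** T c)"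
  proof -
    have "mpow ?D (Suc m) $ b $ c = (\<Sum>e\<in>UNIV. ?D $ b $ e * mpow ?D m $ e $ c)" for c
      by (simp add: matrix_matrix_mult_def)
    then show ?thesis
      by (simp only: of_real_sum of_real_mult mat_sum_mult mat_mult_mat matrix_mult_sum_right
          matrix_mul_assoc) (rule sum.swap)
  qed
  finally show ?case .
qed

text \<open>\<open>D_contracted u\<close> represents \<open>dmult (adj u)\<close> in the basis T_a,
  whose dual basis for the trace form is 2 T_a; hence the factor 2.\<close>

lemma trace_mpow_D_contracted:
  "of_real (trace (mpow (D_contracted u) m)) =
     2 * (\<Sum>a\<in>UNIV. trace (T a ** (dmult (adj u) ^^ m) (T a)))"
proof -
  have "trace (T a ** (dmult (adj u) ^^ m) (T a)) =
      of_real (mpow (D_contracted u) m $ a $ a) / 2" for a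
  proof -
    have "trace (T a ** (dmult (adj u) ^^ m) (T a)) =
        (\<Sum>c\<in>UNIV. of_real (mpow (D_contracted u) m $ a $ c) * trace (T a ** T c))"
      by (simp add: dmult_funpow_generator matrix_mult_sum_right trace_sum trace_mult_mat_mult)
    also have "\<dots> = (\<Sum>c\<in>UNIV. if a = c then of_real (mpow (D_contracted u) m $ a $ c) / 2 else 0)"
      unfolding su_generators_trace_mult[OF generators]
      by (intro sum.cong refl) (simp add: delta_def)
    finally show ?thesis by simp
  qed
  then show ?thesis
    unfolding trace_def[of "mpow (D_contracted u) m"] by (simp only: of_real_sum sum_distrib_left) simp
qed

section \<open>Contractions of d as moments of X\<close>

definition square :: "('a \<Rightarrow> real) \<Rightarrow> 'a \<Rightarrow> real" where
  "square u c = contract u (\<lambda>a. contract u (\<lambda>b. d a b c))"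

lemma contract_self: "of_real (contract u v) = 2 * trace (adj u ** adj v)"
  by (simp add: trace_adj_mult_adj contract_def)

lemma two_adj_square:
  "adj u ** adj u + adj u ** adj u = mat (of_real (contract u u) / of_nat CARD('n)) + adj (square u)"
proof -
  have "adj u ** adj u + adj u ** adj u =
      (\<Sum>a\<in>UNIV. \<Sum>b\<in>UNIV. mat (of_real (u a * u b)) ** (T a ** T b)) +
      (\<Sum>a\<in>UNIV. \<Sum>b\<in>UNIV. mat (of_real (u a * u b)) ** (T b ** T a))"
  proof -
    have 1: "adj u ** adj u = (\<Sum>a\<in>UNIV. \<Sum>b\<in>UNIV. mat (of_real (u a * u b)) ** (T a ** T b))"
      by (simp add: adj_def matrix_mult_sum_left matrix_mult_sum_right mat_mult_mult_mat_mult)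
         (subst sum.swap, simp)
    also have "\<dots> = (\<Sum>a\<in>UNIV. \<Sum>b\<in>UNIV. mat (of_real (u a * u b)) ** (T b ** T a))"
      by (subst sum.swap) (simp add: mult.commute)
    finally show ?thesis using 1 by simp
  qed
  also have "\<dots> = (\<Sum>a\<in>UNIV. \<Sum>b\<in>UNIV. mat (of_real (u a * u b)) ** (T a ** T b + T b ** T a))"
    by (simp add: matrix_add_ldistrib sum.distrib)
  also have "\<dots> = (\<Sum>a\<in>UNIV. \<Sum>b\<in>UNIV. mat (of_real (u a * u b * delta a b) / of_nat CARD('n))) +
      (\<Sum>a\<in>UNIV. \<Sum>b\<in>UNIV. \<Sum>c\<in>UNIV. mat (of_real (u a * u b * d a b c)) ** T c)"
    by (simp add: anticommutator matrix_add_ldistrib sum.distrib mat_mult_mat matrix_mult_sum_right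
        matrix_mul_assoc)
  also have "(\<Sum>a\<in>UNIV. \<Sum>b\<in>UNIV. mat (of_real (u a * u b * delta a b) / of_nat CARD('n))) =
      (mat (of_real (contract u u) / of_nat CARD('n)) :: complex ^ 'n ^ 'n)"
  proof -
    have "(\<Sum>b\<in>UNIV. mat (of_real (u a * u b * delta a b) / of_nat CARD('n))) =
        (\<Sum>b\<in>UNIV. if a = b then mat (of_real (u a * u a) / of_nat CARD('n)) else 0 :: complex ^ 'n ^ 'n)"
      for a by (intro sum.cong refl) (simp add: delta_def)
    then show ?thesis
      using mat_sum_mult[of "\<lambda>a. of_real (u a * u a) / of_nat CARD('n)" UNIV "mat 1", symmetric]
      by (simp add: contract_def sum_divide_distrib)
  qed
  also have "(\<Sum>a\<in>UNIV. \<Sum>b\<in>UNIV. \<Sum>c\<in>UNIV. mat (of_real (u a * u b * d a b c)) ** T c) = adj (square u)"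
  proof -
    have "(\<Sum>a\<in>UNIV. \<Sum>b\<in>UNIV. \<Sum>c\<in>UNIV. mat (of_real (u a * u b * d a b c)) ** T c) =
        (\<Sum>c\<in>UNIV. \<Sum>a\<in>UNIV. \<Sum>b\<in>UNIV. mat (of_real (u a * u b * d a b c)) ** T c)"
      by (subst sum.swap[where A = UNIV and B = UNIV]) (rule sum.swap)
    also have "\<dots> = adj (square u)"
      by (simp only: adj_def square_def contract_def sum_distrib_left of_real_sum mat_sum_mult mult.assoc)
    finally show ?thesis .
  qed
  finally show ?thesis .
qed

lemma adj_square:
  "adj (square u) = mat 2 ** (adj u ** adj u) -
     mat (2 / of_nat CARD('n) * trace (adj u ** adj u))"
  using two_adj_square[of u] unfolding mat_2_mult contract_self
  by (metis add_diff_cancel_left' times_divide_eq_left)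

text \<open>The scalar part of \<open>adj (square u)\<close> drops out because X is traceless. Since
  \<open>u\<close> is arbitrary, the formula can also be applied to \<open>square u\<close> itself,
  which evaluates the contraction of four d tensors.\<close>

lemma contract_square: "of_real (contract u (square u)) = 4 * trace (adj u ** (adj u ** adj u))"
  unfolding contract_self
  by (simp add: adj_square matrix_diff_ldistrib trace_sub trace_mult_mat_mult
      mult_mat_commute trace_mat_mult trace_adj)

definition p :: "('a \<Rightarrow> real) \<Rightarrow> nat \<Rightarrow> complex" where
  "p u k = trace (mpow (adj u) k)"

lemma p_0: "p u 0 = of_nat CARD('n)"
  by (simp add: p_def trace_I)

lemma p_1: "p u 1 = 0"
  by (simp add: p_def trace_adj)

text \<open>The terms without inverse powers of n, namely 2 n p_6 + 30 p_2 p_4 + 20 p_3^2, form the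
  binomial sum for the anticommutator on all of gl(n), with p_0 = n and p_1 = 0. The others are the
  effect of the projections.\<close>

lemma trace_mpow_6_D_contracted:
  "of_real (trace (mpow (D_contracted u) 6)) =
    (2 * of_nat CARD('n) - 384 / of_nat CARD('n)) * p u 6
    + (30 + 384 / (of_nat CARD('n))\<^sup>2) * (p u 2 * p u 4)
    + (20 + 192 / (of_nat CARD('n))\<^sup>2) * (p u 3)\<^sup>2
    - 128 / of_nat CARD('n) ^ 3 * (p u 2) ^ 3"
proof -
  let ?X = "adj u"
  define F where "F m i j =
      (\<Sum>a\<in>UNIV. trace (T a ** (dmult ?X ^^ m) (mpow ?X i ** T a ** mpow ?X j)))" for m i j
  define G where "G m k l =
      (\<Sum>a\<in>UNIV. trace (mpow ?X k ** T a) * trace (T a ** (dmult ?X ^^ m) (mpow ?X l)))" for m k l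
  have "of_real (trace (mpow (D_contracted u) 6)) = 2 * F 6 0 0"
    by (simp add: trace_mpow_D_contracted F_def)
  also have "\<dots> = (2 * of_nat CARD('n) - 384 / of_nat CARD('n)) * p u 6
    + (30 + 384 / (of_nat CARD('n))\<^sup>2) * (p u 2 * p u 4)
    + (20 + 192 / (of_nat CARD('n))\<^sup>2) * (p u 3)\<^sup>2
    - 128 / of_nat CARD('n) ^ 3 * (p u 2) ^ 3"
  proof (rule projected_trace_recursion[where F = F and G = G and p = "p u"])
    show "F 0 i j = p u i * p u j / 2 - p u (i + j) / (2 * of_nat CARD('n))" for i j
      by (simp add: F_def p_def mpow_add su_generators_trace_sandwich[OF generators])
    show "G 0 k l = p u (k + l) / 2 - p u k * p u l / (2 * of_nat CARD('n))" for k l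
      by (simp add: G_def p_def mpow_add su_generators_trace_mult_trace[OF generators])
    show "F (Suc m) i j = F m (Suc i) j + F m i (Suc j) - 2 / of_nat CARD('n) * G m (Suc (i + j)) 0"
      for m i j
      \<comment> \<open>The innermost application is peeled off: it acts on the word, and the other
        m act on the resulting pieces.\<close>
      unfolding F_def G_def funpow_Suc_right o_apply dmult_mpow_sandwich dmult_funpow_diff_mat
        dmult_funpow_add matrix_add_ldistrib matrix_diff_ldistrib trace_add trace_sub
        trace_mult_mat_mult sum.distrib sum_subtractf sum_distrib_left mult.assoc ..
    show "G (Suc m) k l = 2 * G m k (Suc l) - 2 / of_nat CARD('n) * p u (Suc l) * G m k 0" for m k l
      unfolding G_def p_def funpow_Suc_right o_apply dmult_mpow dmult_funpow_diff_mat
        dmult_funpow_mat_mult matrix_diff_ldistrib trace_sub trace_mult_mat_mult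
        sum_distrib_left sum_subtractf[symmetric]
      by (rule sum.cong[OF refl]) (simp add: algebra_simps)
  qed (simp_all add: p_0 p_1[simplified])
  finally show ?thesis .
qed

lemma contract_self_eq_p: "of_real (contract u u) = 2 * p u 2"
  by (simp add: contract_self p_def numeral_2_eq_2)

lemma contract_square_eq_p: "of_real (contract u (square u)) = 4 * p u 3"
  by (simp add: contract_square p_def numeral_3_eq_3)

lemma
  shows contract_square_square_eq_p:
    "of_real (contract (square u) (square u)) = 8 * p u 4 - 8 * (p u 2)\<^sup>2 / of_nat CARD('n)"
  and contract_square_square_square_eq_p:
    "of_real (contract (square u) (square (square u))) =
      32 * (p u 6 - 3 * p u 2 * p u 4 / of_nat CARD('n) + 2 * (p u 2) ^ 3 / (of_nat CARD('n))\<^sup>2)"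
proof -
  let ?Y = "adj u ** adj u"
  have p: "trace ?Y = p u 2" "trace (?Y ** ?Y) = p u 4" "trace (?Y ** (?Y ** ?Y)) = p u 6"
    by (simp_all add: p_def eval_nat_numeral matrix_mul_assoc)
  show "of_real (contract (square u) (square u)) = 8 * p u 4 - 8 * (p u 2)\<^sup>2 / of_nat CARD('n)"
    unfolding contract_self adj_square trace_affine_powers p
    by (simp add: field_simps power2_eq_square)
  show "of_real (contract (square u) (square (square u))) =
      32 * (p u 6 - 3 * p u 2 * p u 4 / of_nat CARD('n) + 2 * (p u 2) ^ 3 / (of_nat CARD('n))\<^sup>2)"
    unfolding contract_square adj_square[of u] trace_affine_powers p
    by (simp add: field_simps power2_eq_square power3_eq_cube)
qed

section \<open>The five tensors of the identity contracted with u\<close>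

lemma contract6_trace:
  assumes D: "D = D_matrix d"
  shows "contract6 (\<lambda>a b c e f g. trace (D a ** D b ** D c ** D e ** D f ** D g)) u =
    trace (mpow (D_contracted u) 6)"
proof -
  let ?U = "D_contracted u"
  have *: "contract u (\<lambda>a. trace (M ** D a ** K)) = trace (M ** ?U ** K)"
    for M K :: "real ^ 'a ^ 'a"
    unfolding D contract_trace_D_matrix D_contracted_def ..
  have "contract u (\<lambda>g. trace (D a ** D b ** D c ** D e ** D f ** D g)) =
      trace (D a ** D b ** D c ** D e ** D f ** ?U)" for a b c e f
    using *[of "D a ** D b ** D c ** D e ** D f" "mat 1"] by simp
  moreover have "contract u (\<lambda>f. trace (D a ** D b ** D c ** D e ** D f ** ?U)) =
      trace (D a ** D b ** D c ** D e ** ?U ** ?U)" for a b c e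
    by (rule *)
  moreover have "contract u (\<lambda>e. trace (D a ** D b ** D c ** D e ** ?U ** ?U)) =
      trace (D a ** D b ** D c ** ?U ** ?U ** ?U)" for a b c
    using *[of "D a ** D b ** D c" "?U ** ?U"] by (simp add: matrix_mul_assoc)
  moreover have "contract u (\<lambda>c. trace (D a ** D b ** D c ** ?U ** ?U ** ?U)) =
      trace (D a ** D b ** ?U ** ?U ** ?U ** ?U)" for a b
    using *[of "D a ** D b" "?U ** ?U ** ?U"] by (simp add: matrix_mul_assoc)
  moreover have "contract u (\<lambda>b. trace (D a ** D b ** ?U ** ?U ** ?U ** ?U)) =
      trace (D a ** ?U ** ?U ** ?U ** ?U ** ?U)" for a
    using *[of "D a" "?U ** ?U ** ?U ** ?U"] by (simp add: matrix_mul_assoc)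
  moreover have "contract u (\<lambda>a. trace (D a ** ?U ** ?U ** ?U ** ?U ** ?U)) =
      trace (?U ** ?U ** ?U ** ?U ** ?U ** ?U)"
    using *[of "mat 1" "?U ** ?U ** ?U ** ?U ** ?U"] by (simp add: matrix_mul_assoc)
  ultimately have "contract6 (\<lambda>a b c e f g. trace (D a ** D b ** D c ** D e ** D f ** D g)) u =
      trace (?U ** ?U ** ?U ** ?U ** ?U ** ?U)"
    unfolding contract6_def by simp
  then show ?thesis by (simp add: eval_nat_numeral matrix_mul_assoc)
qed

text \<open>All three indices meet the same vector, so the order of contraction can be changed until
  the third index is the outermost, as \<open>square\<close> requires.\<close>

lemma contract_d_eq_square:
  "contract v (\<lambda>a. contract v (\<lambda>b. contract v (d a b))) = contract v (square v)"
proof -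
  have "contract v (\<lambda>a. contract v (\<lambda>b. contract v (d a b))) =
      contract v (\<lambda>a. contract v (\<lambda>c. contract v (\<lambda>b. d a b c)))"
    by (rule arg_cong[where f = "contract v"], rule ext, rule contract_swap)
  also have "\<dots> = contract v (\<lambda>c. contract v (\<lambda>a. contract v (\<lambda>b. d a b c)))"
    by (rule contract_swap)
  finally show ?thesis by (simp only: square_def[abs_def])
qed

lemma contract6_dddd:
  "contract6 (\<lambda>a b c e f g. \<Sum>x\<in>UNIV. \<Sum>y\<in>UNIV. \<Sum>z\<in>UNIV. d a b x * d c e y * d f g z * d x y z) u =
     contract (square u) (square (square u))"
proof -
  have "contract6 (\<lambda>a b c e f g. \<Sum>x\<in>UNIV. \<Sum>y\<in>UNIV. \<Sum>z\<in>UNIV. d a b x * d c e y * d f g z * d x y z) u =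
      (\<Sum>x\<in>UNIV. \<Sum>y\<in>UNIV. \<Sum>z\<in>UNIV. square u x * square u y * square u z * d x y z)"
    by (simp add: contract6_def contract_sum contract_mult_left contract_mult_right flip: square_def)
  also have "\<dots> = contract (square u) (\<lambda>x. contract (square u) (\<lambda>y. contract (square u) (\<lambda>z. d x y z)))"
    by (simp add: contract_def sum_distrib_left mult.assoc)
  also have "\<dots> = contract (square u) (square (square u))"
    by (rule contract_d_eq_square)
  finally show ?thesis .
qed

lemma contract6_delta_dd:
  "contract6 (\<lambda>a b c e f g. \<Sum>x\<in>UNIV. delta a b * d c e x * d f g x) u =
     contract u u * contract (square u) (square u)"
proof -
  have "contract6 (\<lambda>a b c e f g. \<Sum>x\<in>UNIV. delta a b * d c e x * d f g x) u =
      (\<Sum>x\<in>UNIV. contract u u * square u x * square u x)"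
    by (simp add: contract6_def contract_sum contract_mult_left contract_mult_right contract_delta
        flip: square_def)
  then show ?thesis by (simp add: contract_def[of "square u"] sum_distrib_left mult.assoc)
qed

lemma contract6_dd:
  "contract6 (\<lambda>a b c e f g. d a b c * d e f g) u = (contract u (square u))\<^sup>2"
proof -
  have "contract6 (\<lambda>a b c e f g. d a b c * d e f g) u =
      (contract u (\<lambda>a. contract u (\<lambda>b. contract u (\<lambda>c. d a b c))))\<^sup>2"
    by (simp add: contract6_def contract_mult_left contract_mult_right power2_eq_square)
  then show ?thesis by (simp only: contract_d_eq_square)
qed

text \<open>The four coefficients solve a triangular system: that of the four-d term comes from p_6,
  that of \<open>(contract u (square u))\<^sup>2\<close> from p_3^2, then the delta-d-d one from p_2
  p_4 and the triple delta one from p_2^3.\<close>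

lemma trace_mpow_6_D_contracted_eq_contract:
  fixes n :: real
  defines "n \<equiv> real CARD('n)"
  shows "trace (mpow (D_contracted u) 6) =
      4 * (n\<^sup>2 - 4) / n ^ 3 * contract u u ^ 3
    + (n\<^sup>2 - 192) / (16 * n) * contract (square u) (square (square u))
    + 3 / 4 * ((3 * n\<^sup>2 - 64) / n\<^sup>2) * (contract u u * contract (square u) (square u))
    + (5 * n\<^sup>2 + 48) / (4 * n\<^sup>2) * (contract u (square u))\<^sup>2" (is "?l = ?r")
proof -
  define N where "N = complex_of_real n"
  have N: "of_nat CARD('n) = N" "N \<noteq> 0" by (simp_all add: N_def n_def)
  have "of_real ?r = 4 * (N\<^sup>2 - 4) / N ^ 3 * (2 * p u 2) ^ 3
    + (N\<^sup>2 - 192) / (16 * N) *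
        (32 * (p u 6 - 3 * p u 2 * p u 4 / N + 2 * (p u 2) ^ 3 / N\<^sup>2))
    + 3 / 4 * ((3 * N\<^sup>2 - 64) / N\<^sup>2) * (2 * p u 2 * (8 * p u 4 - 8 * (p u 2)\<^sup>2 / N))
    + (5 * N\<^sup>2 + 48) / (4 * N\<^sup>2) * (4 * p u 3)\<^sup>2"
    \<comment> \<open>The contractions of \<open>square u\<close> are rewritten first: the general
      rules of the second call match them as well and would yield moments of \<open>square u\<close>
      instead of \<open>u\<close>.\<close>
    by (simp only: of_real_add of_real_diff of_real_mult of_real_divide of_real_power of_real_numeral
        of_real_1 contract_square_square_eq_p contract_square_square_square_eq_p N N_def[symmetric])
      (simp only: contract_self_eq_p contract_square_eq_p)
  also have "\<dots> = of_real ?l"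
    unfolding trace_mpow_6_D_contracted N using N(2)
    by (simp add: field_simps power2_eq_square power3_eq_cube)
  finally show ?thesis by (simp only: of_real_eq_iff)
qed

end

text \<open>By polarisation \<open>sym6 F\<close> is a fixed linear combination of values of
  \<open>contract6 F\<close>, so a linear relation between contractions passes to the symmetrised
  tensors.\<close>

lemma sym6_linear4:
  assumes "\<And>u. contract6 F u = c1 * contract6 F1 u + c2 * contract6 F2 u + c3 * contract6 F3 u
    + c4 * contract6 F4 u"
  shows "sym6 F a b c e f g = c1 * sym6 F1 a b c e f g + c2 * sym6 F2 a b c e f g
    + c3 * sym6 F3 a b c e f g + c4 * sym6 F4 a b c e f g"
  unfolding sym6_polarisation assms
  by (simp add: distrib_left sum.distrib sum_distrib_left add_divide_distrib mult.left_commute)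

theorem mainTheorem16:
  fixes T :: "'a::finite \<Rightarrow> complex ^ 'n::finite ^ 'n"
    and d :: "'a \<Rightarrow> 'a \<Rightarrow> 'a \<Rightarrow> real"
    and D :: "'a \<Rightarrow> real ^ 'a ^ 'a"
    and n :: real
  assumes "n = real CARD('n)"
    and "su_generators T"
    and "is_d_tensor T d"
    and "D = D_matrix d"
  shows "\<forall>i1 i2 i3 i4 i5 i6.
    sym6 (\<lambda>a b c e f g. trace (D a ** D b ** D c ** D e ** D f ** D g)) i1 i2 i3 i4 i5 i6 =
      4 * (n\<^sup>2 - 4) / n ^ 3
        * sym6 (\<lambda>a b c e f g. delta a b * delta c e * delta f g) i1 i2 i3 i4 i5 i6
    + (n\<^sup>2 - 192) / (16 * n)
        * sym6 (\<lambda>a b c e f g. \<Sum>x\<in>UNIV. \<Sum>y\<in>UNIV. \<Sum>z\<in>UNIV.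
                   d a b x * d c e y * d f g z * d x y z) i1 i2 i3 i4 i5 i6
    + 3 / 4 * ((3 * n\<^sup>2 - 64) / n\<^sup>2)
        * sym6 (\<lambda>a b c e f g. \<Sum>x\<in>UNIV. delta a b * d c e x * d f g x) i1 i2 i3 i4 i5 i6
    + (5 * n\<^sup>2 + 48) / (4 * n\<^sup>2)
        * sym6 (\<lambda>a b c e f g. d a b c * d e f g) i1 i2 i3 i4 i5 i6"
proof -
  interpret su_tensor T d using assms by unfold_locales
  show ?thesis
    by (intro allI sym6_linear4)
      (simp only: assms(1) contract6_trace[OF assms(4)] contract6_delta contract6_dddd
        contract6_delta_dd contract6_dd trace_mpow_6_D_contracted_eq_contract)
qed

end
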